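(* Let $\{X_n\}_{n\ge0}$ be a Markov chain with state space $\{1,2,3\}$ and transition matrix $P=[p_{ij}]$. The recurrence time distribution $f_{11}^{(n)}=P\{T_{11}=n\}$ of state $1$ is given by $$f_{11}^{(1)}=p_{11},\quad f_{11}^{(2)}=p_{12}p_{21}+p_{13}p_{31},\quad f_{11}^{(3)}=p_{12}p_{22}p_{21}+p_{12}p_{23}p_{31}+p_{13}p_{32}p_{21}+p_{13}p_{33}p_{31},$$ and, in general, for $n\ge4$, $$f_{11}^{(n)}=\{p_{12}p_{23}p_{31}+p_{13}p_{32}p_{21}+p_{12}p_{21}p_{22}+p_{13}p_{31}p_{33}\}a_{n-3}+(p_{12}p_{21}+p_{13}p_{31})(p_{23}p_{32}-p_{22}p_{33})a_{n-4},$$ where $a_0=1$, $a_1=p_{22}+p_{33}$, $a_2=p_{22}^2+p_{33}^2+p_{22}p_{33}+p_{23}p_{32}$, $a_3=(p_{22}+p_{33})(p_{22}^2+p_{33}^2+2p_{23}p_{32})$, $a_4=(p_{22}+p_{33})^2\{(p_{22}-p_{33})^2+p_{22}p_{33}+3p_{23}p_{32}\}+(p_{23}p_{32}-p_{22}p_{33})^2$, and, for $n\ge2$, $$a_n=(p_{22}+p_{33})a_{n-1}+(p_{23}p_{32}-p_{22}p_{33})a_{n-2}.$$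
   Context: $T_{11}=\min\{n\ge1:X_n=1\}$ given $X_0=1$, so $f_{11}^{(n)}=P\{X_n=1,\ X_k\ne1\text{ for }k=1,\dots,n-1\mid X_0=1\}$. The sequence $(a_n)$ is determined by $a_0$, $a_1$ and the recurrence; the displayed values of $a_2,a_3,a_4$ are part of the assertion (they agree with the recurrence). *)

theory Defs
  imports "HOL-Probability.Probability" "HOL-Library.Extended_Nat"
begin

text \<open>
  A time-homogeneous Markov chain with finite state space \<open>S\<close>, transition matrix \<open>P\<close> and arbitrary
  initial distribution. Only histories of positive probability are constrained, since \<open>cond_prob\<close>
  is \<open>0\<close> when the conditioning event is null.
\<close>

locale finite_markov_chain = prob_space M
  for M :: "'a measure" and S :: "'s set" and P :: "'s \<Rightarrow> 's \<Rightarrow> real" and X :: "nat \<Rightarrow> 'a \<Rightarrow> 's" +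
  assumes finite_states: "finite S"
    and random_variable_X: "\<And>n. X n \<in> measurable M (count_space S)"
    and transition_nonneg: "\<And>i j. i \<in> S \<Longrightarrow> j \<in> S \<Longrightarrow> 0 \<le> P i j"
    and transition_row_sum: "\<And>i. i \<in> S \<Longrightarrow> (\<Sum>j\<in>S. P i j) = 1"
    and markov_property: "\<And>n s j. (\<And>k. k \<le> n \<Longrightarrow> s k \<in> S) \<Longrightarrow> j \<in> S \<Longrightarrow>
          \<P>(\<omega> in M. \<forall>k\<le>n. X k \<omega> = s k) > 0 \<Longrightarrow>
          \<P>(\<omega> in M. X (Suc n) \<omega> = j \<bar> \<forall>k\<le>n. X k \<omega> = s k) = P (s n) j"

text \<open>The value is \<open>\<infinity>\<close> if the state is never visited after time \<open>0\<close>.\<close>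

definition recurrence_time :: "(nat \<Rightarrow> 'a \<Rightarrow> 's) \<Rightarrow> 's \<Rightarrow> 'a \<Rightarrow> enat" where
  "recurrence_time X i \<omega> = Inf (enat ` {n. 1 \<le> n \<and> X n \<omega> = i})"

definition recurrence_prob :: "'a measure \<Rightarrow> (nat \<Rightarrow> 'a \<Rightarrow> 's) \<Rightarrow> 's \<Rightarrow> nat \<Rightarrow> real" where
  "recurrence_prob M X i n = \<P>(\<omega> in M. recurrence_time X i \<omega> = enat n \<bar> X 0 \<omega> = i)"

end

theory Submission
  imports Defs
begin

text \<open>
  Summing the Markov property over histories, the joint law of \<open>X (n + 1)\<close> and the event of avoiding
  \<open>i\<close> at times \<open>1, \<dots>, n\<close> evolves by the transition matrix with row \<open>i\<close> removed. For three states and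
  \<open>n \<ge> 2\<close> this gives \<open>f n = u Q\<^sup>n\<^sup>-\<^sup>2 v\<close> with the \<open>2 \<times> 2\<close> block \<open>Q\<close> on the states \<open>2, 3\<close>, so by
  Cayley-Hamilton \<open>f\<close> satisfies the recurrence of \<open>a\<close>, which has the coefficients \<open>tr Q\<close> and \<open>- det Q\<close>.
\<close>

text \<open>The index is shifted by one: \<open>n\<close> counts the intermediate times at which
  \<open>i\<close> is forbidden, so the move to \<open>j\<close> takes place at time
  \<open>n + 1\<close>. The endpoint \<open>j\<close> may be \<open>i\<close> itself, which yields
  the first-return probabilities.\<close>

primrec taboo_prob :: "'s set \<Rightarrow> ('s \<Rightarrow> 's \<Rightarrow> real) \<Rightarrow> 's \<Rightarrow> nat \<Rightarrow> 's \<Rightarrow> real" where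
  "taboo_prob S P i 0 j = P i j"
| "taboo_prob S P i (Suc n) j = (\<Sum>k\<in>S - {i}. taboo_prob S P i n k * P k j)"

lemma recurrence_time_eq_enat_Suc_iff:
  "recurrence_time X i \<omega> = enat (Suc n) \<longleftrightarrow> (\<forall>k\<in>{1..n}. X k \<omega> \<noteq> i) \<and> X (Suc n) \<omega> = i"
proof -
  let ?A = "{n. 1 \<le> n \<and> X n \<omega> = i}"
  show ?thesis
  proof
    assume T: "recurrence_time X i \<omega> = enat (Suc n)"
    \<comment> \<open>The infimum of the empty set in \<open>enat\<close> is infinity, so a finite
      value forces a visit; well-ordering then makes the infimum attained.\<close>
    have "?A \<noteq> {}"
    proof
      assume "?A = {}"
      then have "enat ` ?A = {}" by (simp only: image_empty)
      with T show False
        by (simp add: recurrence_time_def Inf_enat_def)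
    qed
    then obtain m where "m \<in> ?A" by blast
    then have "Inf (enat ` ?A) \<in> enat ` ?A"
      by (rule wellorder_InfI[OF imageI])
    then have "Suc n \<in> ?A"
      using T by (auto simp: recurrence_time_def)
    moreover have "X k \<omega> \<noteq> i" if "k \<in> {1..n}" for k
    proof
      assume "X k \<omega> = i"
      with that have "Inf (enat ` ?A) \<le> enat k"
        by (intro Inf_lower) auto
      with T that show False
        by (simp add: recurrence_time_def)
    qed
    ultimately show "(\<forall>k\<in>{1..n}. X k \<omega> \<noteq> i) \<and> X (Suc n) \<omega> = i"
      by auto
  next
    assume H: "(\<forall>k\<in>{1..n}. X k \<omega> \<noteq> i) \<and> X (Suc n) \<omega> = i"
    show "recurrence_time X i \<omega> = enat (Suc n)"
      unfolding recurrence_time_def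
    proof (rule Inf_eqI)
      fix x assume "x \<in> enat ` ?A"
      then obtain k where k: "x = enat k" "1 \<le> k" "X k \<omega> = i" by auto
      with H have "k \<notin> {1..n}" by blast
      with k show "enat (Suc n) \<le> x" by simp
    next
      fix y assume "\<And>x. x \<in> enat ` ?A \<Longrightarrow> y \<le> x"
      with H show "y \<le> enat (Suc n)" by auto
    qed
  qed
qed

section \<open>One-step law given an event of the past\<close>

context finite_markov_chain
begin

lemma X_in_S: "\<omega> \<in> space M \<Longrightarrow> X n \<omega> \<in> S"
  using random_variable_X[of n] by (auto dest: measurable_space)

lemma X_eq_in_events: "{\<omega> \<in> space M. X n \<omega> = j} \<in> events"
proof -
  have "X n -` ({j} \<inter> S) \<inter> space M \<in> events"
    using random_variable_X by (rule measurable_sets) simp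
  also have "X n -` ({j} \<inter> S) \<inter> space M = {\<omega> \<in> space M. X n \<omega> = j}"
    using X_in_S by auto
  finally show ?thesis .
qed

lemma history_in_events: "{\<omega> \<in> space M. \<forall>k\<le>n. X k \<omega> = s k} \<in> events"
proof -
  have "{\<omega> \<in> space M. \<forall>k\<in>{..n}. X k \<omega> = s k} \<in> events"
    by (intro sets.sets_Collect_finite_All' X_eq_in_events) auto
  then show ?thesis by (simp only: Ball_def atMost_iff)
qed

text \<open>In product form the Markov property needs no positivity condition: for a null history
  both sides vanish by monotonicity.\<close>

lemma prob_history_step:
  assumes "\<And>k. k \<le> n \<Longrightarrow> s k \<in> S" "j \<in> S"
  shows "\<P>(\<omega> in M. (\<forall>k\<le>n. X k \<omega> = s k) \<and> X (Suc n) \<omega> = j)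
    = \<P>(\<omega> in M. \<forall>k\<le>n. X k \<omega> = s k) * P (s n) j"
proof (cases "\<P>(\<omega> in M. \<forall>k\<le>n. X k \<omega> = s k) > 0")
  case True
  from markov_property[OF assms True] True show ?thesis
    by (simp add: cond_prob_def field_simps conj_commute)
next
  case False
  then have zero: "\<P>(\<omega> in M. \<forall>k\<le>n. X k \<omega> = s k) = 0"
    by (simp add: zero_less_measure_iff)
  have "\<P>(\<omega> in M. (\<forall>k\<le>n. X k \<omega> = s k) \<and> X (Suc n) \<omega> = j) \<le> \<P>(\<omega> in M. \<forall>k\<le>n. X k \<omega> = s k)"
    by (intro finite_measure_mono history_in_events) auto
  with zero show ?thesis
    by (simp add: measure_le_0_iff)
qed

text \<open>By \<open>past\<close>, \<open>Q\<close> is a property of the path up to time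
  \<open>n\<close>, so its event is a finite disjoint union of histories. By \<open>last\<close> all
  of them end in \<open>i\<close>, so each contributes the same factor \<open>P i j\<close>, which
  comes out of the sum.\<close>

lemma prob_past_step:
  assumes j: "j \<in> S"
    and past: "\<And>s t. (\<And>k. k \<le> n \<Longrightarrow> s k = t k) \<Longrightarrow> Q s \<longleftrightarrow> Q t"
    and last: "\<And>s. Q s \<Longrightarrow> s n = i"
  shows "\<P>(\<omega> in M. Q (\<lambda>k. X k \<omega>) \<and> X (Suc n) \<omega> = j) = \<P>(\<omega> in M. Q (\<lambda>k. X k \<omega>)) * P i j"
proof -
  define H where "H = {h \<in> {..n} \<rightarrow>\<^sub>E S. Q h}"
  define E where "E h = {\<omega> \<in> space M. \<forall>k\<le>n. X k \<omega> = h k}" for h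
  define F where "F h = {\<omega> \<in> space M. (\<forall>k\<le>n. X k \<omega> = h k) \<and> X (Suc n) \<omega> = j}" for h
  have fin: "finite H"
    unfolding H_def using finite_PiE[of "{..n}" "\<lambda>_. S"] finite_states by simp
  have split: "Q (\<lambda>k. X k \<omega>) \<longleftrightarrow> (\<exists>h\<in>H. \<forall>k\<le>n. X k \<omega> = h k)" if "\<omega> \<in> space M" for \<omega>
  proof
    assume Q: "Q (\<lambda>k. X k \<omega>)"
    \<comment> \<open>The path itself need not lie in \<open>H\<close>, whose members are
      \<open>undefined\<close> after time \<open>n\<close>. Extensionality is also what makes
      distinct members of \<open>H\<close> differ at some time up to \<open>n\<close>, hence the
      disjointness below.\<close>
    have "Q (restrict (\<lambda>k. X k \<omega>) {..n}) \<longleftrightarrow> Q (\<lambda>k. X k \<omega>)"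
      by (intro past) auto
    with Q that have "restrict (\<lambda>k. X k \<omega>) {..n} \<in> H"
      by (auto simp: H_def X_in_S)
    then show "\<exists>h\<in>H. \<forall>k\<le>n. X k \<omega> = h k" by (rule bexI[rotated]) auto
  next
    assume "\<exists>h\<in>H. \<forall>k\<le>n. X k \<omega> = h k"
    then obtain h where "Q h" "\<And>k. k \<le> n \<Longrightarrow> X k \<omega> = h k" by (auto simp: H_def)
    then show "Q (\<lambda>k. X k \<omega>)" using past[of "\<lambda>k. X k \<omega>" h] by blast
  qed
  have eq: "g = h" if "g \<in> H" "h \<in> H" "\<And>k. k \<le> n \<Longrightarrow> g k = h k" for g h
    using that by (intro PiE_ext[of g "{..n}" "\<lambda>_. S" h]) (auto simp: H_def)
  have E: "E h \<in> events" for h unfolding E_def by (rule history_in_events)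
  have disjE: "disjoint_family_on E H"
    unfolding disjoint_family_on_def
  proof (intro ballI impI)
    fix g h assume gh: "g \<in> H" "h \<in> H" "g \<noteq> h"
    then obtain k where "k \<le> n" "g k \<noteq> h k" using eq by blast
    then show "E g \<inter> E h = {}" by (auto simp: E_def)
  qed
  have FE: "F h = E h \<inter> {\<omega> \<in> space M. X (Suc n) \<omega> = j}" for h
    by (auto simp: F_def E_def)
  have F: "F h \<in> events" for h unfolding FE by (intro sets.Int E X_eq_in_events)
  have disjF: "disjoint_family_on F H"
    by (rule disjoint_family_on_bisimulation[OF disjE]) (auto simp: FE)
  have "{\<omega> \<in> space M. Q (\<lambda>k. X k \<omega>) \<and> X (Suc n) \<omega> = j} = (\<Union>h\<in>H. F h)"
    using split by (auto simp: F_def)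
  then have "\<P>(\<omega> in M. Q (\<lambda>k. X k \<omega>) \<and> X (Suc n) \<omega> = j) = (\<Sum>h\<in>H. prob (F h))"
    using finite_measure_finite_Union[OF fin _ disjF] F by auto
  also have "\<dots> = (\<Sum>h\<in>H. prob (E h) * P i j)"
  proof (rule sum.cong)
    fix h assume h: "h \<in> H"
    then have "h n = i" using last by (auto simp: H_def)
    moreover have "h k \<in> S" if "k \<le> n" for k using h that by (auto simp: H_def)
    ultimately show "prob (F h) = prob (E h) * P i j"
      unfolding E_def F_def using prob_history_step[of n h j] j by simp
  qed simp
  also have "\<dots> = (\<Sum>h\<in>H. prob (E h)) * P i j"
    by (simp add: sum_distrib_right)
  also have "(\<Sum>h\<in>H. prob (E h)) = prob (\<Union>h\<in>H. E h)"
    using E by (intro finite_measure_finite_Union[OF fin _ disjE, symmetric]) auto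
  also have "(\<Union>h\<in>H. E h) = {\<omega> \<in> space M. Q (\<lambda>k. X k \<omega>)}"
    using split by (auto simp: E_def)
  finally show ?thesis .
qed

section \<open>Return probabilities as taboo probabilities\<close>

lemma taboo_event_in_events:
  "{\<omega> \<in> space M. X 0 \<omega> = i \<and> (\<forall>k\<in>{1..n}. X k \<omega> \<noteq> i) \<and> X (Suc n) \<omega> = j} \<in> events"
  by (intro sets.sets_Collect_conj sets.sets_Collect_finite_All sets.sets_Collect_neg
      X_eq_in_events finite_atLeastAtMost)

lemma prob_taboo:
  assumes "j \<in> S"
  shows "\<P>(\<omega> in M. X 0 \<omega> = i \<and> (\<forall>k\<in>{1..n}. X k \<omega> \<noteq> i) \<and> X (Suc n) \<omega> = j)
    = \<P>(\<omega> in M. X 0 \<omega> = i) * taboo_prob S P i n j"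
  using assms
proof (induction n arbitrary: j)
  case 0
  then show ?case
    using prob_past_step[of j 0 "\<lambda>s. s 0 = i" i] by simp
next
  case (Suc n)
  let ?B = "\<lambda>l. {\<omega> \<in> space M.
    (X 0 \<omega> = i \<and> (\<forall>k\<in>{1..n}. X k \<omega> \<noteq> i) \<and> X (Suc n) \<omega> = l) \<and> X (Suc (Suc n)) \<omega> = j}"
  have B: "?B l \<in> events" for l
    by (intro sets.sets_Collect_conj taboo_event_in_events X_eq_in_events)
  \<comment> \<open>Time \<open>Suc n\<close> is now a forbidden time, so splitting by the state
    there gives only \<open>l\<close> in \<open>S - {i}\<close>, the index set of the sum defining
    \<open>taboo_prob\<close>.\<close>
  have "{\<omega> \<in> space M. X 0 \<omega> = i \<and> (\<forall>k\<in>{1..Suc n}. X k \<omega> \<noteq> i) \<and> X (Suc (Suc n)) \<omega> = j}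
    = (\<Union>l\<in>S - {i}. ?B l)"
    using X_in_S by (auto simp: atLeastAtMostSuc_conv)
  then have "\<P>(\<omega> in M. X 0 \<omega> = i \<and> (\<forall>k\<in>{1..Suc n}. X k \<omega> \<noteq> i) \<and> X (Suc (Suc n)) \<omega> = j)
    = (\<Sum>l\<in>S - {i}. prob (?B l))"
    using finite_measure_finite_Union[of "S - {i}" ?B] B finite_states
    by (auto simp: disjoint_family_on_def)
  also have "\<dots> = (\<Sum>l\<in>S - {i}. \<P>(\<omega> in M. X 0 \<omega> = i) * taboo_prob S P i n l * P l j)"
  proof (rule sum.cong)
    fix l assume l: "l \<in> S - {i}"
    have "prob (?B l) =
      \<P>(\<omega> in M. X 0 \<omega> = i \<and> (\<forall>k\<in>{1..n}. X k \<omega> \<noteq> i) \<and> X (Suc n) \<omega> = l) * P l j"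
      using Suc.prems by (rule prob_past_step) auto
    with Suc.IH[of l] l
    show "prob (?B l) = \<P>(\<omega> in M. X 0 \<omega> = i) * taboo_prob S P i n l * P l j" by simp
  qed simp
  finally show ?case
    by (simp add: sum_distrib_left mult.assoc)
qed

text \<open>This is \<open>prob_taboo\<close> with endpoint \<open>i\<close>; the positive initial
  probability cancels in the conditional probability.\<close>

lemma recurrence_prob_Suc:
  assumes "i \<in> S" "\<P>(\<omega> in M. X 0 \<omega> = i) > 0"
  shows "recurrence_prob M X i (Suc n) = taboo_prob S P i n i"
proof -
  have "{\<omega> \<in> space M. recurrence_time X i \<omega> = enat (Suc n) \<and> X 0 \<omega> = i}
    = {\<omega> \<in> space M. X 0 \<omega> = i \<and> (\<forall>k\<in>{1..n}. X k \<omega> \<noteq> i) \<and> X (Suc n) \<omega> = i}"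
    by (auto simp: recurrence_time_eq_enat_Suc_iff)
  with assms show ?thesis
    unfolding recurrence_prob_def cond_prob_def by (simp only: prob_taboo) simp
qed

end

section \<open>Three states and the second-order recurrence\<close>

theorem corollary4p2:
  fixes M :: "'a measure" and p :: "nat \<Rightarrow> nat \<Rightarrow> real" and X :: "nat \<Rightarrow> 'a \<Rightarrow> nat"
    and a :: "nat \<Rightarrow> real"
  assumes chain: "finite_markov_chain M {1, 2, 3} p X"
    and start: "\<P>(\<omega> in M. X 0 \<omega> = 1) > 0"
    and a0: "a 0 = 1"
    and a1: "a 1 = p 2 2 + p 3 3"
    and a_rec: "\<And>n. n \<ge> 2 \<Longrightarrow>
      a n = (p 2 2 + p 3 3) * a (n - 1) + (p 2 3 * p 3 2 - p 2 2 * p 3 3) * a (n - 2)"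
  shows "recurrence_prob M X 1 1 = p 1 1
    \<and> recurrence_prob M X 1 2 = p 1 2 * p 2 1 + p 1 3 * p 3 1
    \<and> recurrence_prob M X 1 3 =
        p 1 2 * p 2 2 * p 2 1 + p 1 2 * p 2 3 * p 3 1 + p 1 3 * p 3 2 * p 2 1 + p 1 3 * p 3 3 * p 3 1
    \<and> (\<forall>n\<ge>4. recurrence_prob M X 1 n =
        (p 1 2 * p 2 3 * p 3 1 + p 1 3 * p 3 2 * p 2 1 + p 1 2 * p 2 1 * p 2 2 + p 1 3 * p 3 1 * p 3 3)
          * a (n - 3)
        + (p 1 2 * p 2 1 + p 1 3 * p 3 1) * (p 2 3 * p 3 2 - p 2 2 * p 3 3) * a (n - 4))
    \<and> a 2 = (p 2 2)\<^sup>2 + (p 3 3)\<^sup>2 + p 2 2 * p 3 3 + p 2 3 * p 3 2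
    \<and> a 3 = (p 2 2 + p 3 3) * ((p 2 2)\<^sup>2 + (p 3 3)\<^sup>2 + 2 * p 2 3 * p 3 2)
    \<and> a 4 = (p 2 2 + p 3 3)\<^sup>2 * ((p 2 2 - p 3 3)\<^sup>2 + p 2 2 * p 3 3 + 3 * p 2 3 * p 3 2)
        + (p 2 3 * p 3 2 - p 2 2 * p 3 3)\<^sup>2"
proof -
  interpret finite_markov_chain M "{1, 2, 3}" p X by (rule chain)
  define s where "s = p 2 2 + p 3 3"
  define d where "d = p 2 3 * p 3 2 - p 2 2 * p 3 3"
  define t where "t = taboo_prob {1, 2, 3} p 1"
  define A where "A = p 1 2 * p 2 3 * p 3 1 + p 1 3 * p 3 2 * p 2 1
    + p 1 2 * p 2 1 * p 2 2 + p 1 3 * p 3 1 * p 3 3"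
  define B where "B = p 1 2 * p 2 1 + p 1 3 * p 3 1"
  have f: "recurrence_prob M X 1 (Suc n) = t n 1" for n
    unfolding t_def using start by (intro recurrence_prob_Suc) auto
  have "{1, 2, 3} - {1} = {2, 3 :: nat}" by auto
  then have t0: "t 0 j = p 1 j" and tS: "t (Suc n) j = t n 2 * p 2 j + t n 3 * p 3 j" for n j
    by (simp_all add: t_def)
  define g where "g n = t n 1" for n
  \<comment> \<open>This is Cayley-Hamilton in expanded form, with \<open>s\<close> the trace and
    \<open>d\<close> minus the determinant of the block on 2 and 3. It starts at
    \<open>g (Suc 0)\<close> because \<open>g 0 = p 1 1\<close> is a direct return that does not
    pass through this block.\<close>
  have g_rec: "g (Suc (Suc (Suc n))) = s * g (Suc (Suc n)) + d * g (Suc n)" for n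
    by (simp only: g_def tS s_def d_def) (simp add: algebra_simps)
  have g1: "g (Suc 0) = B" and g2: "g (Suc (Suc 0)) = A"
    by (simp_all only: g_def tS t0 A_def B_def) (simp_all add: algebra_simps)
  have a_one: "a (Suc 0) = s"
    using a1 by (simp add: s_def)
  have a_Suc: "a (Suc (Suc n)) = s * a (Suc n) + d * a n" for n
    using a_rec[of "Suc (Suc n)"] by (simp add: s_def d_def)
  \<comment> \<open>Both sides satisfy the same second-order recurrence in \<open>n\<close>, so
    agreement at 0 and 1 suffices. At 0 the claim is \<open>g_rec\<close> applied to the initial
    values \<open>B\<close> and \<open>A\<close>.\<close>
  have g_eq: "g (Suc (Suc (Suc n))) = A * a (Suc n) + B * d * a n" for n
  proof (induction n rule: induct_nat_012)
    case 0
    show ?case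
      by (simp add: g_rec g1 g2 a0 a_one)
  next
    case 1
    show ?case
      by (simp add: g_rec g1 g2 a0 a_one a_Suc algebra_simps)
  next
    case (ge2 n)
    have "g (Suc (Suc (Suc (Suc (Suc n))))) =
      s * g (Suc (Suc (Suc (Suc n)))) + d * g (Suc (Suc (Suc n)))"
      by (rule g_rec)
    also have "\<dots> = A * (s * a (Suc (Suc n)) + d * a (Suc n)) + B * d * (s * a (Suc n) + d * a n)"
      by (simp only: ge2) (simp add: algebra_simps)
    finally show ?case
      by (simp only: a_Suc)
  qed
  have "recurrence_prob M X 1 n = A * a (n - 3) + B * d * a (n - 4)" if "n \<ge> 4" for n
  proof -
    \<comment> \<open>The return at time \<open>m + 4\<close> is \<open>g (m + 3)\<close>, so
      \<open>g_eq\<close> at \<open>m\<close> supplies \<open>a (n - 3)\<close> and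
      \<open>a (n - 4)\<close>; this is where the bound 4 comes from.\<close>
    obtain m where m: "n = Suc (Suc (Suc (Suc m)))"
      using le_Suc_ex[OF \<open>n \<ge> 4\<close>] by (auto simp: eval_nat_numeral)
    show ?thesis
      unfolding m f g_def[symmetric] g_eq by (simp add: eval_nat_numeral)
  qed
  moreover have "recurrence_prob M X 1 1 = p 1 1" "recurrence_prob M X 1 2 = B"
    using f[of 0] f[of "Suc 0"] t0 g1 by (simp_all add: g_def eval_nat_numeral)
  moreover have "recurrence_prob M X 1 3 = p 1 2 * p 2 2 * p 2 1 + p 1 2 * p 2 3 * p 3 1
    + p 1 3 * p 3 2 * p 2 1 + p 1 3 * p 3 3 * p 3 1"
  proof -
    have "recurrence_prob M X 1 3 = A"
      using f[of "Suc (Suc 0)"] g2 by (simp add: g_def eval_nat_numeral)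
    then show ?thesis by (simp add: A_def)
  qed
  moreover have "a 2 = (p 2 2)\<^sup>2 + (p 3 3)\<^sup>2 + p 2 2 * p 3 3 + p 2 3 * p 3 2"
  proof -
    \<comment> \<open>The displayed values of \<open>a\<close> are first computed as polynomials in
      \<open>s\<close> and \<open>d\<close>; only then are the matrix entries substituted.\<close>
    have "a 2 = s * s + d"
      by (simp add: eval_nat_numeral a_Suc a0 a_one)
    then show ?thesis unfolding s_def d_def by algebra
  qed
  moreover have "a 3 = (p 2 2 + p 3 3) * ((p 2 2)\<^sup>2 + (p 3 3)\<^sup>2 + 2 * p 2 3 * p 3 2)"
  proof -
    have "a 3 = s * (s * s + 2 * d)"
      by (simp add: numeral_3_eq_3 a_Suc a0 a_one algebra_simps)
    then show ?thesis unfolding s_def d_def by algebra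
  qed
  moreover have "a 4 = (p 2 2 + p 3 3)\<^sup>2 * ((p 2 2 - p 3 3)\<^sup>2 + p 2 2 * p 3 3 + 3 * p 2 3 * p 3 2)
    + (p 2 3 * p 3 2 - p 2 2 * p 3 3)\<^sup>2"
  proof -
    have "a 4 = a (Suc (Suc (Suc (Suc 0))))" by (simp add: eval_nat_numeral)
    also have "\<dots> = s * s * (s * s + 3 * d) + d * d"
      by (simp add: a_Suc a0 a_one algebra_simps)
    finally show ?thesis unfolding s_def d_def by algebra
  qed
  ultimately show ?thesis
    unfolding A_def B_def d_def by (intro conjI allI impI)
qed

end
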